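(* Consider the multi-type Galton-Watson tree $\mathcal{T}$ and the normal, misère and escape games on it, with the sets $S_j$, generating functions $G_{j,S}$, constants $\alpha_j,\beta_j$ and outcome probabilities described in the context. (Normal game.) Define $F_N=(F_{N,j}:j\in[m])$ and $\mathcal{F}_N=(\mathcal{F}_{N,j}:j\in[m])$, mapping $[0,1]^m$ to itself, by $$F_{N,j}(x_1,\ldots,x_m)=1-G_{j,S_j}\big(1-G_{k,[m]\setminus S_k}(x_\ell:\ell\in[m]\setminus S_k):k\in S_j\big),$$ $$\mathcal{F}_{N,j}(x_1,\ldots,x_m)=1-G_{j,[m]\setminus S_j}\big(1-G_{k,S_k}(x_\ell:\ell\in S_k):k\in[m]\setminus S_j\big).$$ Then $$\mathbf{nw}_1=\min\mathrm{FP}(F_N),\quad \mathbf{nl}_1=\mathbf{1}_{[m]}-\max\mathrm{FP}(F_N),\quad \mathbf{nw}_2=\min\mathrm{FP}(\mathcal{F}_N),\quad \mathbf{nl}_2=\mathbf{1}_{[m]}-\max\mathrm{FP}(\mathcal{F}_N).$$ (Misère game.) Define $F_M=(F_{M,j}:j\in[m])$ and $\mathcal{F}_M=(\mathcal{F}_{M,j}:j\in[m])$, mapping $[0,1]^m$ to itself, by $$F_{M,j}(x_1,\ldots,x_m)=\alpha_j+1-G_{j,S_j}\big(1-G_{k,[m]\setminus S_k}(x_\ell:\ell\in[m]\setminus S_k)+\beta_k:k\in S_j\big),$$ $$\mathcal{F}_{M,j}(x_1,\ldots,x_m)=\beta_j+1-G_{j,[m]\setminus S_j}\big(1-G_{k,S_k}(x_\ell:\ell\in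 S_k)+\alpha_k:k\in[m]\setminus S_j\big).$$ Then $$\mathbf{mw}_1=\min\mathrm{FP}(F_M),\quad \mathbf{ml}_1=\mathbf{1}_{[m]}-\max\mathrm{FP}(F_M),\quad \mathbf{mw}_2=\min\mathrm{FP}(\mathcal{F}_M),\quad \mathbf{ml}_2=\mathbf{1}_{[m]}-\max\mathrm{FP}(\mathcal{F}_M).$$ (Escape game.) Define $F_E=(F_{E,j}:j\in[m])$ and $\mathcal{F}_E=(\mathcal{F}_{E,j}:j\in[m])$, mapping $[0,1]^m$ to itself, by $$F_{E,j}(x_1,\ldots,x_m)=\alpha_j+1-G_{j,S_j}\big(1-G_{k,[m]\setminus S_k}(x_\ell:\ell\in[m]\setminus S_k):k\in S_j\big),$$ $$\mathcal{F}_{E,j}(x_1,\ldots,x_m)=1-G_{j,[m]\setminus S_j}\big(\alpha_k+1-G_{k,S_k}(x_\ell:\ell\in S_k):k\in[m]\setminus S_j\big).$$ Then $$\mathbf{esw}=\min\mathrm{FP}(F_E),\qquad \mathbf{eel}=\mathbf{1}_{[m]}-\max\mathrm{FP}(\mathcal{F}_E).$$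
   Context: Tree. $[m]=\{1,\ldots,m\}$ is a finite set of colours, $\mathbf{p}=(p_1,\ldots,p_m)$ a probability vector, and $\chi_1,\ldots,\chi_m$ probability distributions on $\mathbb{N}_0^m$. The rooted multi-type Galton-Watson tree $\mathcal{T}$ is generated as follows: the root $\phi$ gets a colour $\sigma(\phi)\in[m]$ according to $\mathbf{p}$; then every vertex $v$ with colour $\sigma(v)=i$ gives birth, independently of all else, to $X_{v,j}$ children of colour $j$ for all $j\in[m]$, where $(X_{v,1},\ldots,X_{v,m})\sim\chi_i$. Edges $(u,v)$ are directed from parent $u$ to child $v$. Games. For each $j\in[m]$ a non-empty proper subset $S_j$ of $[m]$ is fixed. A directed edge $(u,v)$ is permissible for P1 (in the normal and misère games) and for Stopper (in the escape game) if $\sigma(v)\in S_{\sigma(u)}$; it is permissible for P2 and for Escaper if $\sigma(v)\in[m]\setminus S_{\sigma(u)}$. A token is placed on an initial vertex, and the two players alternately move it along a directed edge permissible for the player whose turn it is. Normal game (P1 vs P2): the first player who is unable to move loses. Misère game (P1 vs P2): the first player who is unable to move wins. In both, if no player is ever unable to move, the game is a draw. Escape game (Stopper vs Escaper): if either player is ever unable to move, Stopper wins; otherwise Escaper wins. Outcomes are those under optimal play (a player wins if she has a winning strategy; a game is a draw if neither player has one). Outcome probabilities. For $i=1,2$ and $j\in[m]$, conditioned on $\sigma(\phi)=j$: $\mathrm{nw}_{i,j}$ (resp. $\mathrm{nl}_{i,j}$) is the probability that the normal game with initial vertex $\phi$ and with P$i$ playing the first round is won (resp. lost) by P$i$; $\mathrm{mw}_{i,j}$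 and $\mathrm{ml}_{i,j}$ are the analogous probabilities for the misère game; $\mathrm{esw}_j$ is the probability that Stopper wins the escape game with initial vertex $\phi$ when Stopper plays the first round; $\mathrm{eel}_j$ is the probability that Escaper loses the escape game with initial vertex $\phi$ when Escaper plays the first round. Vectors: $\mathbf{nw}_i=(\mathrm{nw}_{i,j}:j\in[m])$, and likewise $\mathbf{nl}_i,\mathbf{mw}_i,\mathbf{ml}_i,\mathbf{esw},\mathbf{eel}$. Generating functions. For $S\subseteq[m]$, $\chi_{j,S}$ is the law of $(X_{v,k}:k\in S)$ given $\sigma(v)=j$, and $G_{j,S}$ is its probability generating function, $G_{j,S}(x_k:k\in S)=\sum_{(n_k)\in\mathbb{N}_0^{S}}\prod_{k\in S}x_k^{n_k}\,\chi_{j,S}(n_k:k\in S)$. $\alpha_j$ (resp. $\beta_j$) is the probability, conditioned on $\sigma(\phi)=j$, that $\phi$ has no child of colour $k$ for any $k\in S_j$ (resp. any $k\in[m]\setminus S_j$). Order and fixed points. $(x_i)\preceq(y_i)$ means $x_i\le y_i$ for all $i$. For $f:[0,1]^m\to[0,1]^m$, $\mathrm{FP}(f)=\{\mathbf{x}\in[0,1]^m:f(\mathbf{x})=\mathbf{x}\}$; $\min\mathrm{FP}(f)$ (resp. $\max\mathrm{FP}(f)$) denotes the element of $\mathrm{FP}(f)$ that is $\preceq$ (resp. $\succeq$) every element of $\mathrm{FP}(f)$; the equalities in the claim include the assertion that these exist. $\mathbf{1}_{[m]}=(1,\ldots,1)$. *)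

theory Defs
  imports "HOL-Probability.Probability"
begin

section \<open>The multi-type Galton-Watson tree\<close>

text \<open>
  The set of colours \<open>[m]\<close> is a finite type \<open>'m\<close>. Vertices carry Ulam-Harris labels: the root is
  the empty list and \<open>v @ [(k, n)]\<close> is the \<open>n\<close>-th child of colour \<open>k\<close> of \<open>v\<close> (counting from 0).
\<close>

type_synonym 'm vertex = "('m \<times> nat) list"

text \<open>
  A sample point consists of the colour of the root and, for every label \<open>v\<close> and colour \<open>i\<close>, the
  offspring vector that \<open>v\<close> has in case its colour is \<open>i\<close>.
\<close>

type_synonym 'm gw_sample = "'m \<times> ('m vertex \<times> 'm \<Rightarrow> 'm \<Rightarrow> nat)"

definition gw_measure :: "'m::finite pmf \<Rightarrow> ('m \<Rightarrow> ('m \<Rightarrow> nat) pmf) \<Rightarrow> 'm gw_sample measure" where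
  "gw_measure p chi = measure_pmf p \<Otimes>\<^sub>M PiM UNIV (\<lambda>(v, i). measure_pmf (chi i))"

definition colour :: "'m gw_sample \<Rightarrow> 'm vertex \<Rightarrow> 'm" where
  "colour \<omega> v = (if v = [] then fst \<omega> else fst (last v))"

definition offspring :: "'m gw_sample \<Rightarrow> 'm vertex \<Rightarrow> 'm \<Rightarrow> nat" where
  "offspring \<omega> v = snd \<omega> (v, colour \<omega> v)"

inductive_set vertices :: "'m gw_sample \<Rightarrow> 'm vertex set" for \<omega> :: "'m gw_sample" where
  root: "[] \<in> vertices \<omega>"
| child: "u \<in> vertices \<omega> \<Longrightarrow> n < offspring \<omega> u k \<Longrightarrow> u @ [(k, n)] \<in> vertices \<omega>"

definition edge :: "'m gw_sample \<Rightarrow> 'm vertex \<Rightarrow> 'm vertex \<Rightarrow> bool" where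
  "edge \<omega> u v \<longleftrightarrow> u \<in> vertices \<omega> \<and> (\<exists>k n. n < offspring \<omega> u k \<and> v = u @ [(k, n)])"

text \<open>
  Probability conditioned on the root having colour \<open>j\<close>. If that event is null, the conditional law
  is understood, as usual, to be the law of the tree whose root has colour \<open>j\<close>.
\<close>

definition prob_given_root ::
    "'m::finite pmf \<Rightarrow> ('m \<Rightarrow> ('m \<Rightarrow> nat) pmf) \<Rightarrow> 'm \<Rightarrow> ('m gw_sample \<Rightarrow> bool) \<Rightarrow> real" where
  "prob_given_root p chi j A =
     (if pmf p j > 0 then cond_prob (gw_measure p chi) A (\<lambda>\<omega>. colour \<omega> [] = j)
      else \<P>(\<omega> in gw_measure (return_pmf j) chi. A \<omega>))"


section \<open>The games\<close>

datatype player = P1 | P2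

abbreviation (input) Stopper :: player where "Stopper \<equiv> P1"
abbreviation (input) Escaper :: player where "Escaper \<equiv> P2"

fun opponent :: "player \<Rightarrow> player" where
  "opponent P1 = P2"
| "opponent P2 = P1"

datatype game = Normal | Misere | Escape

text \<open>\<open>E\<close> is the edge relation of a rooted tree whose vertices are coloured by \<open>\<sigma>\<close>.\<close>

fun permissible :: "('m \<Rightarrow> 'm set) \<Rightarrow> ('v \<Rightarrow> 'm) \<Rightarrow> player \<Rightarrow> 'v \<Rightarrow> 'v \<Rightarrow> bool" where
  "permissible S \<sigma> P1 u v \<longleftrightarrow> \<sigma> v \<in> S (\<sigma> u)"
| "permissible S \<sigma> P2 u v \<longleftrightarrow> \<sigma> v \<in> - S (\<sigma> u)"

definition moves ::
    "('m \<Rightarrow> 'm set) \<Rightarrow> ('v \<Rightarrow> 'v \<Rightarrow> bool) \<Rightarrow> ('v \<Rightarrow> 'm) \<Rightarrow> player \<Rightarrow> 'v \<Rightarrow> 'v set" where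
  "moves S E \<sigma> a u = {v. E u v \<and> permissible S \<sigma> a u v}"

text \<open>
  A strategy assigns to each vertex at which the player can move the vertex to move to. Since a play
  starts at the root of a tree, the current vertex determines the whole history of the play (and
  whose turn it is), so this covers history-dependent strategies.
\<close>

definition strategy ::
    "('m \<Rightarrow> 'm set) \<Rightarrow> ('v \<Rightarrow> 'v \<Rightarrow> bool) \<Rightarrow> ('v \<Rightarrow> 'm) \<Rightarrow> player \<Rightarrow> ('v \<Rightarrow> 'v) \<Rightarrow> bool" where
  "strategy S E \<sigma> a s \<longleftrightarrow> (\<forall>u. moves S E \<sigma> a u \<noteq> {} \<longrightarrow> s u \<in> moves S E \<sigma> a u)"

definition mover :: "player \<Rightarrow> nat \<Rightarrow> player" where
  "mover first n = (if even n then first else opponent first)"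

text \<open>
  Position of the token after \<open>n\<close> moves, when player \<open>first\<close> moves first and each player \<open>a\<close> follows
  \<open>\<tau> a\<close>; it is \<open>None\<close> if the play has ended before that.
\<close>

primrec play ::
    "('m \<Rightarrow> 'm set) \<Rightarrow> ('v \<Rightarrow> 'v \<Rightarrow> bool) \<Rightarrow> ('v \<Rightarrow> 'm) \<Rightarrow> 'v \<Rightarrow> player \<Rightarrow> (player \<Rightarrow> 'v \<Rightarrow> 'v) \<Rightarrow> nat
      \<Rightarrow> 'v option" where
  "play S E \<sigma> v\<^sub>0 first \<tau> 0 = Some v\<^sub>0"
| "play S E \<sigma> v\<^sub>0 first \<tau> (Suc n) =
     (case play S E \<sigma> v\<^sub>0 first \<tau> n of
        None \<Rightarrow> None
      | Some u \<Rightarrow> if moves S E \<sigma> (mover first n) u = {} then None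
                  else Some (\<tau> (mover first n) u))"

definition gets_stuck ::
    "('m \<Rightarrow> 'm set) \<Rightarrow> ('v \<Rightarrow> 'v \<Rightarrow> bool) \<Rightarrow> ('v \<Rightarrow> 'm) \<Rightarrow> 'v \<Rightarrow> player \<Rightarrow> (player \<Rightarrow> 'v \<Rightarrow> 'v)
      \<Rightarrow> player \<Rightarrow> bool" where
  "gets_stuck S E \<sigma> v\<^sub>0 first \<tau> a \<longleftrightarrow>
     (\<exists>n u. mover first n = a \<and> play S E \<sigma> v\<^sub>0 first \<tau> n = Some u \<and> moves S E \<sigma> a u = {})"

text \<open>\<open>won_by g stuck a\<close>: \<open>a\<close> wins a play of \<open>g\<close> in which the players satisfying \<open>stuck\<close> get stuck.\<close>

fun won_by :: "game \<Rightarrow> (player \<Rightarrow> bool) \<Rightarrow> player \<Rightarrow> bool" where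
  "won_by Normal stuck a \<longleftrightarrow> stuck (opponent a)"
| "won_by Misere stuck a \<longleftrightarrow> stuck a"
| "won_by Escape stuck a \<longleftrightarrow>
     (if a = Stopper then (\<exists>b. stuck b) else \<not> (\<exists>b. stuck b))"

definition wins ::
    "game \<Rightarrow> ('m \<Rightarrow> 'm set) \<Rightarrow> ('v \<Rightarrow> 'v \<Rightarrow> bool) \<Rightarrow> ('v \<Rightarrow> 'm) \<Rightarrow> 'v \<Rightarrow> player \<Rightarrow> player \<Rightarrow> bool" where
  "wins g S E \<sigma> v\<^sub>0 first a \<longleftrightarrow>
     (\<exists>s. strategy S E \<sigma> a s \<and>
        (\<forall>t. strategy S E \<sigma> (opponent a) t \<longrightarrow>
           won_by g (gets_stuck S E \<sigma> v\<^sub>0 first (\<lambda>b. if b = a then s else t)) a))"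

definition loses ::
    "game \<Rightarrow> ('m \<Rightarrow> 'm set) \<Rightarrow> ('v \<Rightarrow> 'v \<Rightarrow> bool) \<Rightarrow> ('v \<Rightarrow> 'm) \<Rightarrow> 'v \<Rightarrow> player \<Rightarrow> player \<Rightarrow> bool" where
  "loses g S E \<sigma> v\<^sub>0 first a \<longleftrightarrow> wins g S E \<sigma> v\<^sub>0 first (opponent a)"


section \<open>Outcome probabilities\<close>

definition win_prob ::
    "game \<Rightarrow> 'm::finite pmf \<Rightarrow> ('m \<Rightarrow> ('m \<Rightarrow> nat) pmf) \<Rightarrow> ('m \<Rightarrow> 'm set) \<Rightarrow> player \<Rightarrow> 'm \<Rightarrow> real" where
  "win_prob g p chi S a j = prob_given_root p chi j (\<lambda>\<omega>. wins g S (edge \<omega>) (colour \<omega>) [] a a)"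

definition loss_prob ::
    "game \<Rightarrow> 'm::finite pmf \<Rightarrow> ('m \<Rightarrow> ('m \<Rightarrow> nat) pmf) \<Rightarrow> ('m \<Rightarrow> 'm set) \<Rightarrow> player \<Rightarrow> 'm \<Rightarrow> real" where
  "loss_prob g p chi S a j = prob_given_root p chi j (\<lambda>\<omega>. loses g S (edge \<omega>) (colour \<omega>) [] a a)"

abbreviation "nw \<equiv> win_prob Normal"
abbreviation "nl \<equiv> loss_prob Normal"
abbreviation "mw \<equiv> win_prob Misere"
abbreviation "ml \<equiv> loss_prob Misere"
abbreviation "esw p chi S \<equiv> win_prob Escape p chi S Stopper"
abbreviation "eel p chi S \<equiv> loss_prob Escape p chi S Escaper"

definition \<alpha> ::
    "'m::finite pmf \<Rightarrow> ('m \<Rightarrow> ('m \<Rightarrow> nat) pmf) \<Rightarrow> ('m \<Rightarrow> 'm set) \<Rightarrow> 'm \<Rightarrow> real" where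
  "\<alpha> p chi S j = prob_given_root p chi j (\<lambda>\<omega>. \<forall>k\<in>S j. \<not> (\<exists>v. edge \<omega> [] v \<and> colour \<omega> v = k))"

definition \<beta> ::
    "'m::finite pmf \<Rightarrow> ('m \<Rightarrow> ('m \<Rightarrow> nat) pmf) \<Rightarrow> ('m \<Rightarrow> 'm set) \<Rightarrow> 'm \<Rightarrow> real" where
  "\<beta> p chi S j = prob_given_root p chi j (\<lambda>\<omega>. \<forall>k\<in>- S j. \<not> (\<exists>v. edge \<omega> [] v \<and> colour \<omega> v = k))"


section \<open>Generating functions and the fixed-point maps\<close>

definition marginal :: "('m \<Rightarrow> ('m \<Rightarrow> nat) pmf) \<Rightarrow> 'm \<Rightarrow> 'm set \<Rightarrow> ('m \<Rightarrow> nat) pmf" where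
  "marginal chi j A = map_pmf (\<lambda>n. restrict n A) (chi j)"

definition G :: "('m::finite \<Rightarrow> ('m \<Rightarrow> nat) pmf) \<Rightarrow> 'm \<Rightarrow> 'm set \<Rightarrow> ('m \<Rightarrow> real) \<Rightarrow> real" where
  "G chi j A x = (\<Sum>\<^sub>\<infinity>n\<in>(A \<rightarrow>\<^sub>E UNIV). (\<Prod>k\<in>A. x k ^ n k) * pmf (marginal chi j A) n)"

context
  fixes p :: "'m::finite pmf"
    and chi :: "'m \<Rightarrow> ('m \<Rightarrow> nat) pmf"
    and S :: "'m \<Rightarrow> 'm set"
begin

definition F_N :: "('m \<Rightarrow> real) \<Rightarrow> 'm \<Rightarrow> real" where
  "F_N x j = 1 - G chi j (S j) (\<lambda>k. 1 - G chi k (- S k) x)"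

definition F_N' :: "('m \<Rightarrow> real) \<Rightarrow> 'm \<Rightarrow> real" where
  "F_N' x j = 1 - G chi j (- S j) (\<lambda>k. 1 - G chi k (S k) x)"

definition F_M :: "('m \<Rightarrow> real) \<Rightarrow> 'm \<Rightarrow> real" where
  "F_M x j = \<alpha> p chi S j + 1 - G chi j (S j) (\<lambda>k. 1 - G chi k (- S k) x + \<beta> p chi S k)"

definition F_M' :: "('m \<Rightarrow> real) \<Rightarrow> 'm \<Rightarrow> real" where
  "F_M' x j = \<beta> p chi S j + 1 - G chi j (- S j) (\<lambda>k. 1 - G chi k (S k) x + \<alpha> p chi S k)"

definition F_E :: "('m \<Rightarrow> real) \<Rightarrow> 'm \<Rightarrow> real" where
  "F_E x j = \<alpha> p chi S j + 1 - G chi j (S j) (\<lambda>k. 1 - G chi k (- S k) x)"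

definition F_E' :: "('m \<Rightarrow> real) \<Rightarrow> 'm \<Rightarrow> real" where
  "F_E' x j = 1 - G chi j (- S j) (\<lambda>k. \<alpha> p chi S k + 1 - G chi k (S k) x)"

end

definition cube :: "('m \<Rightarrow> real) set" where
  "cube = (UNIV \<rightarrow> {0..1})"

definition FP :: "(('m \<Rightarrow> real) \<Rightarrow> 'm \<Rightarrow> real) \<Rightarrow> ('m \<Rightarrow> real) set" where
  "FP f = {x \<in> cube. f x = x}"

text \<open>The order on \<open>'m \<Rightarrow> real\<close> is the pointwise one.\<close>

definition is_min_FP :: "(('m \<Rightarrow> real) \<Rightarrow> 'm \<Rightarrow> real) \<Rightarrow> ('m \<Rightarrow> real) \<Rightarrow> bool" where
  "is_min_FP f z \<longleftrightarrow> z \<in> FP f \<and> (\<forall>y\<in>FP f. z \<le> y)"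

definition is_max_FP :: "(('m \<Rightarrow> real) \<Rightarrow> 'm \<Rightarrow> real) \<Rightarrow> ('m \<Rightarrow> real) \<Rightarrow> bool" where
  "is_max_FP f z \<longleftrightarrow> z \<in> FP f \<and> (\<forall>y\<in>FP f. y \<le> z)"

end

theory Submission
  imports Defs
begin

text \<open>
  All ten claims have one form: fix a game, a player \<open>W\<close> whose victory is asked for, and a player \<open>b\<close>
  who moves first. In each case an infinite play is not a victory for \<open>W\<close> (the player whose victory
  in the escape game is asked for is always Stopper).

  The trees are locally finite. Hence, by compactness, \<open>W\<close> has a winning strategy if and only if she
  can force a win within \<open>n\<close> rounds for some \<open>n\<close>
  (\<open>wins_within_imp_wins\<close>, \<open>wins_imp_wins_within\<close>): if no bound existed at a position of her
  opponent, some child would have no bound either, because there are finitely many children, so the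
  opponent could stay unbounded forever.

  Let \<open>q\<^sub>n\<^sub>,\<^sub>b j\<close> be the probability that \<open>W\<close> can force a win within \<open>n\<close> rounds when \<open>b\<close> starts at a
  root of colour \<open>j\<close>. The subtrees at the children of the root are independent Galton-Watson trees,
  independent of the offspring vector of the root, so the probability that all permissible children
  of the root have a given property is a value of the generating function (\<open>prob_all_children\<close>).
  If the opponent starts, \<open>W\<close> needs all permissible children to be good; if \<open>W\<close> starts, she needs
  them not to be all bad; if there are none, the game is over and its rules decide. This gives
  \<open>q\<^sub>n\<^sub>+\<^sub>1\<^sub>,\<^sub>b = T\<^sub>b q\<^sub>n\<^sub>,\<^sub>b\<^sub>'\<close>, with \<open>b'\<close> the opponent of \<open>b\<close>,
  for an explicit map \<open>T\<^sub>b\<close> of the cube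
  (\<open>prob_within_Suc\<close>). The maps \<open>T\<^sub>b\<close> are monotone and continuous and \<open>q\<^sub>0\<^sub>,\<^sub>b = 0\<close>, so the
  winning probability \<open>lim\<^sub>n q\<^sub>n\<^sub>,\<^sub>b\<close> is the least fixed point of \<open>T\<^sub>b \<circ> T\<^sub>b\<^sub>'\<close>
  (\<open>is_min_FP_prob_eventually\<close>).

  For \<open>b = W\<close> the composed map is, up to the order of summands, one of the maps \<open>F\<close> of the
  theorem. For \<open>b \<noteq> W\<close>, when the winning probability of \<open>W\<close> is the losing probability of the
  player who starts, it is such a map conjugated with \<open>x \<mapsto> 1 - x\<close>, which exchanges least and
  greatest fixed points (\<open>is_max_FP_reflect\<close>).
\<close>


section \<open>Games that are won in finitely many rounds\<close>

lemma opponent_opponent [simp]: "opponent (opponent a) = a"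
  by (cases a) auto

lemma opponent_neq [simp]: "opponent a \<noteq> a" "a \<noteq> opponent a"
  by (cases a; simp)+

lemma eq_opponent_iff: "b = opponent a \<longleftrightarrow> b \<noteq> a"
  by (cases a; cases b) auto

definition stuck_win :: "game \<Rightarrow> player \<Rightarrow> player \<Rightarrow> bool" where
  "stuck_win g W b \<longleftrightarrow> won_by g (\<lambda>c. c = b) W"

text \<open>
  The player \<open>W\<close> can force a win from \<open>v\<close>, with \<open>b\<close> to move, in such a way that the play stops after
  fewer than \<open>n\<close> moves: the round in which a player finds herself unable to move is counted.
  Only plays that stop are counted, so this describes games in which
  an infinite play is not a victory for \<open>W\<close>.
\<close>

primrec wins_within ::
    "game \<Rightarrow> ('m \<Rightarrow> 'm set) \<Rightarrow> ('v \<Rightarrow> 'v \<Rightarrow> bool) \<Rightarrow> ('v \<Rightarrow> 'm) \<Rightarrow> player \<Rightarrow> nat \<Rightarrow> player \<Rightarrow> 'v \<Rightarrow> bool"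
  where
  "wins_within g S E \<sigma> W 0 b v = False"
| "wins_within g S E \<sigma> W (Suc n) b v =
     (if moves S E \<sigma> b v = {} then stuck_win g W b
      else if b = W then \<exists>w\<in>moves S E \<sigma> b v. wins_within g S E \<sigma> W n (opponent b) w
      else \<forall>w\<in>moves S E \<sigma> b v. wins_within g S E \<sigma> W n (opponent b) w)"

lemma wins_within_Suc_mono:
  "wins_within g S E \<sigma> W n b v \<Longrightarrow> wins_within g S E \<sigma> W (Suc n) b v"
proof (induction n arbitrary: b v)
  case (Suc n)
  let ?M = "moves S E \<sigma> b v" and ?win = "wins_within g S E \<sigma> W"
  have "(?M = {} \<longrightarrow> stuck_win g W b)
      \<and> (?M \<noteq> {} \<longrightarrow> b = W \<longrightarrow> (\<exists>w\<in>?M. ?win n (opponent b) w))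
      \<and> (?M \<noteq> {} \<longrightarrow> b \<noteq> W \<longrightarrow> (\<forall>w\<in>?M. ?win n (opponent b) w))"
    using Suc.prems by (simp split: if_splits)
  then have "(?M = {} \<longrightarrow> stuck_win g W b)
      \<and> (?M \<noteq> {} \<longrightarrow> b = W \<longrightarrow> (\<exists>w\<in>?M. ?win (Suc n) (opponent b) w))
      \<and> (?M \<noteq> {} \<longrightarrow> b \<noteq> W \<longrightarrow> (\<forall>w\<in>?M. ?win (Suc n) (opponent b) w))"
    using Suc.IH by blast
  then show ?case
    by (simp only: wins_within.simps(2)[of g S E \<sigma> W "Suc n"] split: if_split) blast
qed simp

lemma wins_within_mono:
  assumes "wins_within g S E \<sigma> W n b v" "n \<le> n'"
  shows "wins_within g S E \<sigma> W n' b v"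
  using assms(2,1) by (induction rule: dec_induct) (auto intro: wins_within_Suc_mono simp del: wins_within.simps)

lemma mover_Suc: "mover first (Suc n) = opponent (mover first n)"
  by (simp add: mover_def)

lemma play_ends_when_stuck:
  assumes "play S E \<sigma> v0 first \<tau> n = Some u" "moves S E \<sigma> (mover first n) u = {}" "n < n'"
  shows "play S E \<sigma> v0 first \<tau> n' = None"
  using assms(3) by (induction n') (use assms(1,2) in \<open>auto simp: less_Suc_eq\<close>)

text \<open>
  A play stops at most once, so its result depends only on who was to move when it stopped; this is
  why \<open>stuck_win\<close> captures the rules of all three games.
\<close>

lemma gets_stuck_unique:
  assumes "play S E \<sigma> v0 first \<tau> n = Some u" "moves S E \<sigma> (mover first n) u = {}"
  shows "gets_stuck S E \<sigma> v0 first \<tau> = (\<lambda>c. c = mover first n)"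
proof (rule ext, rule iffI)
  fix c assume "gets_stuck S E \<sigma> v0 first \<tau> c"
  then obtain n' u' where n': "mover first n' = c" "play S E \<sigma> v0 first \<tau> n' = Some u'"
    "moves S E \<sigma> c u' = {}" unfolding gets_stuck_def by blast
  have "\<not> n < n'" "\<not> n' < n"
    using play_ends_when_stuck[OF assms, of n'] play_ends_when_stuck[of S E \<sigma> v0 first \<tau> n' u' n] n' assms
    by auto
  then show "c = mover first n" using n' by (metis linorder_neqE_nat)
next
  fix c assume "c = mover first n"
  then show "gets_stuck S E \<sigma> v0 first \<tau> c" using assms unfolding gets_stuck_def by blast
qed

text \<open>
  The winning strategy moves to a child that can be won in the least number of rounds; that number
  then decreases along every play. It depends only on the position, as strategies have to.
\<close>

lemma wins_within_imp_wins:
  assumes "wins_within g S E \<sigma> W n first v0"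
  shows "wins g S E \<sigma> v0 first W"
proof -
  let ?win = "\<lambda>n b v. wins_within g S E \<sigma> W n b v"
  let ?M = "moves S E \<sigma>"
  have "\<exists>w. ?M W u \<noteq> {} \<longrightarrow> w \<in> ?M W u \<and>
          (\<forall>n. (\<exists>w'\<in>?M W u. ?win n (opponent W) w') \<longrightarrow> ?win n (opponent W) w)" for u
  proof (cases "\<exists>n. \<exists>w'\<in>?M W u. ?win n (opponent W) w'")
    case True
    from LeastI_ex[OF True] obtain w where
      w: "w \<in> ?M W u" "?win (LEAST n. \<exists>w'\<in>?M W u. ?win n (opponent W) w') (opponent W) w" by blast
    then have "?win n (opponent W) w" if "\<exists>w'\<in>?M W u. ?win n (opponent W) w'" for n
      using wins_within_mono Least_le that by (metis (mono_tags, lifting))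
    with w show ?thesis by blast
  qed auto
  then obtain s where s: "\<And>u. ?M W u \<noteq> {} \<Longrightarrow> s u \<in> ?M W u"
    "\<And>u n w'. w' \<in> ?M W u \<Longrightarrow> ?win n (opponent W) w' \<Longrightarrow> ?win n (opponent W) (s u)"
    by (metis empty_iff)
  have strat: "strategy S E \<sigma> W s" using s(1) by (simp add: strategy_def)
  show ?thesis unfolding wins_def
  proof (intro exI[of _ s] conjI strat allI impI)
    fix t assume t: "strategy S E \<sigma> (opponent W) t"
    let ?\<tau> = "\<lambda>b. if b = W then s else t"
    let ?p = "play S E \<sigma> v0 first ?\<tau>"
    have "\<exists>k' u'. ?p k' = Some u' \<and> ?M (mover first k') u' = {} \<and> stuck_win g W (mover first k')"
      if "?p k = Some u" "?win n (mover first k) u" for n k u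
      using that
    proof (induction n arbitrary: k u)
      case (Suc n)
      show ?case
      proof (cases "?M (mover first k) u = {}")
        case True
        then show ?thesis using Suc.prems by auto
      next
        case ne: False
        have next_pos: "?p (Suc k) = Some (?\<tau> (mover first k) u)" using Suc.prems ne by simp
        have "?win n (mover first (Suc k)) (?\<tau> (mover first k) u)"
        proof (cases "mover first k = W")
          case True
          then show ?thesis using Suc.prems ne s(2) by (auto simp: mover_Suc)
        next
          case False
          then have "t u \<in> ?M (mover first k) u"
            using t ne eq_opponent_iff[of "mover first k" W] by (auto simp: strategy_def)
          then show ?thesis using Suc.prems ne False by (auto simp: mover_Suc)
        qed
        then show ?thesis using Suc.IH[OF next_pos] by blast
      qed
    qed simp
    from this[of 0 v0 n] assms obtain k u where "?p k = Some u" "?M (mover first k) u = {}"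
      "stuck_win g W (mover first k)" by (auto simp: mover_def)
    then show "won_by g (gets_stuck S E \<sigma> v0 first ?\<tau>) W"
      using gets_stuck_unique[of S E \<sigma> v0 first ?\<tau> k u] by (simp add: stuck_win_def)
  qed
qed

text \<open>
  Call a position safe if \<open>W\<close> can force no win there within any number of rounds. The opponent can
  always move from a safe position to a safe one: if each of the finitely many children were won
  within some number of rounds, the maximum of these numbers would work for the parent. So a safe
  starting position stays safe, and the play either never stops or stops with \<open>W\<close> not winning.
\<close>

lemma wins_imp_wins_within:
  assumes fin: "\<And>b u. finite (moves S E \<sigma> b u)"
    and inf: "\<not> won_by g (\<lambda>_. False) W"
    and wins: "wins g S E \<sigma> v0 first W"
  shows "\<exists>n. wins_within g S E \<sigma> W n first v0"
proof (rule ccontr)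
  let ?M = "moves S E \<sigma>"
  define safe where "safe b u \<longleftrightarrow> (\<forall>n. \<not> wins_within g S E \<sigma> W n b u)" for b u
  assume "\<not> ?thesis"
  then have safe0: "safe first v0" by (simp add: safe_def)
  have safe_W: "safe (opponent W) w" if "safe W u" "w \<in> ?M W u" for u w
    unfolding safe_def
  proof
    fix n
    have "\<not> wins_within g S E \<sigma> W (Suc n) W u" using that(1) unfolding safe_def by blast
    then show "\<not> wins_within g S E \<sigma> W n (opponent W) w" using that(2) by (auto split: if_splits)
  qed
  have safe_opp: "\<exists>w\<in>?M (opponent W) u. safe W w" if "safe (opponent W) u" "?M (opponent W) u \<noteq> {}" for u
  proof (rule ccontr)
    assume "\<not> ?thesis"
    then obtain r where r: "wins_within g S E \<sigma> W (r w) W w" if "w \<in> ?M (opponent W) u" for w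
      unfolding safe_def by metis
    have "wins_within g S E \<sigma> W (Max (r ` ?M (opponent W) u)) W w" if "w \<in> ?M (opponent W) u" for w
      using r[OF that] by (rule wins_within_mono) (use fin that in auto)
    then have "wins_within g S E \<sigma> W (Suc (Max (r ` ?M (opponent W) u))) (opponent W) u"
      using that(2) by auto
    then show False using that(1) unfolding safe_def by blast
  qed
  have safe_stuck: "\<not> stuck_win g W b" if "safe b u" "?M b u = {}" for b u
  proof -
    have "\<not> wins_within g S E \<sigma> W (Suc 0) b u" using that(1) unfolding safe_def by blast
    then show ?thesis using that(2) by simp
  qed
  have "\<exists>w. ?M (opponent W) u \<noteq> {} \<longrightarrow> w \<in> ?M (opponent W) u \<and> (safe (opponent W) u \<longrightarrow> safe W w)" for u
    using safe_opp[of u] by blast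
  then obtain t where t: "\<And>u. ?M (opponent W) u \<noteq> {} \<Longrightarrow> t u \<in> ?M (opponent W) u"
    "\<And>u. ?M (opponent W) u \<noteq> {} \<Longrightarrow> safe (opponent W) u \<Longrightarrow> safe W (t u)"
    by metis
  obtain s where s: "strategy S E \<sigma> W s"
    and s_wins: "\<And>t. strategy S E \<sigma> (opponent W) t \<Longrightarrow>
      won_by g (gets_stuck S E \<sigma> v0 first (\<lambda>b. if b = W then s else t)) W"
    using wins unfolding wins_def by blast
  let ?\<tau> = "\<lambda>b. if b = W then s else t"
  let ?p = "play S E \<sigma> v0 first ?\<tau>"
  have won: "won_by g (gets_stuck S E \<sigma> v0 first ?\<tau>) W"
    using t(1) by (intro s_wins) (simp add: strategy_def)
  have safe_play: "?p k = Some u \<Longrightarrow> safe (mover first k) u" for k u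
  proof (induction k arbitrary: u)
    case 0
    then show ?case using safe0 by (simp add: mover_def)
  next
    case (Suc k)
    then obtain u' where u': "?p k = Some u'" "?M (mover first k) u' \<noteq> {}"
      "u = ?\<tau> (mover first k) u'"
      by (auto split: option.splits if_splits)
    have "safe (mover first k) u'" by (rule Suc.IH[OF u'(1)])
    then show ?case
      using u' safe_W[of u'] s t(2)[of u'] eq_opponent_iff[of "mover first k" W]
      by (cases "mover first k = W") (auto simp: mover_Suc strategy_def)
  qed
  show False
  proof (cases "\<exists>c. gets_stuck S E \<sigma> v0 first ?\<tau> c")
    case True
    then obtain k u where k: "?p k = Some u" "?M (mover first k) u = {}"
      by (auto simp: gets_stuck_def)
    show False
      using won safe_stuck[OF safe_play[OF k(1)] k(2)] gets_stuck_unique[OF k]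
      by (simp add: stuck_win_def)
  next
    case False
    then have "gets_stuck S E \<sigma> v0 first ?\<tau> = (\<lambda>_. False)" by auto
    then show False using won inf by simp
  qed
qed

section \<open>Self-similarity of the tree\<close>

definition allowed :: "('m \<Rightarrow> 'm set) \<Rightarrow> player \<Rightarrow> 'm \<Rightarrow> 'm set" where
  "allowed S b j = (case b of P1 \<Rightarrow> S j | P2 \<Rightarrow> - S j)"

text \<open>
  A sample point assigns offspring vectors to labels and colours; relabelling it by the descendants of
  \<open>u\<close> gives the sample point that generates the tree hanging from \<open>u\<close>.
\<close>

definition subtree :: "'m vertex \<Rightarrow> ('m vertex \<times> 'm \<Rightarrow> 'b) \<Rightarrow> 'm vertex \<times> 'm \<Rightarrow> 'b" where
  "subtree u f = (\<lambda>(v, i). f (u @ v, i))"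

lemma moves_root:
  "moves S (edge \<omega>) (colour \<omega>) b [] =
     {[(k, i)] |k i. k \<in> allowed S b (fst \<omega>) \<and> i < snd \<omega> ([], fst \<omega>) k}"
  by (cases b) (auto simp: moves_def edge_def colour_def offspring_def allowed_def intro: vertices.root)

lemma finite_moves:
  fixes \<omega> :: "'m::finite gw_sample"
  shows "finite (moves S (edge \<omega>) (colour \<omega>) b u)"
proof (rule finite_subset)
  show "moves S (edge \<omega>) (colour \<omega>) b u
      \<subseteq> (\<lambda>c. u @ [c]) ` (SIGMA k:UNIV. {..<offspring \<omega> u k})"
    by (auto simp: moves_def edge_def image_def)
qed auto

context
  fixes \<omega> :: "'m gw_sample" and k :: 'm and i :: nat
  assumes child: "i < offspring \<omega> [] k"
begin

private abbreviation "\<omega>' \<equiv> (k, subtree [(k, i)] (snd \<omega>))"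

lemma colour_subtree: "colour \<omega> ((k, i) # v) = colour \<omega>' v"
  by (simp add: colour_def)

lemma offspring_subtree: "offspring \<omega> ((k, i) # v) = offspring \<omega>' v"
  by (simp add: offspring_def colour_subtree subtree_def)

lemma vertices_subtree: "(k, i) # v \<in> vertices \<omega> \<longleftrightarrow> v \<in> vertices \<omega>'"
proof
  have "v \<in> vertices \<omega>'" if "u \<in> vertices \<omega>" "u = (k, i) # v" for u v
    using that
  proof (induction arbitrary: v rule: vertices.induct)
    case (child u n c)
    show ?case
    proof (cases u)
      case Nil
      then show ?thesis using child by (auto intro: vertices.root)
    next
      case (Cons a u')
      then have v: "u = (k, i) # u'" "v = u' @ [(c, n)]" using child.prems by auto
      show ?thesis
        using child.IH[OF v(1)] child.hyps v by (auto intro!: vertices.child simp: offspring_subtree)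
    qed
  qed simp
  then show "(k, i) # v \<in> vertices \<omega> \<Longrightarrow> v \<in> vertices \<omega>'" by blast
next
  assume "v \<in> vertices \<omega>'"
  then show "(k, i) # v \<in> vertices \<omega>"
  proof (induction rule: vertices.induct)
    case root
    show ?case using vertices.child[OF vertices.root child] by simp
  next
    case (child u n c)
    then show ?case using vertices.child[of "(k, i) # u" \<omega> n c] by (simp add: offspring_subtree)
  qed
qed

lemma moves_subtree:
  "moves S (edge \<omega>) (colour \<omega>) b ((k, i) # v) = (#) (k, i) ` moves S (edge \<omega>') (colour \<omega>') b v"
  by (cases b)
    (auto simp: moves_def edge_def vertices_subtree offspring_subtree colour_subtree)

lemma wins_within_subtree:
  "wins_within g S (edge \<omega>) (colour \<omega>) W n b ((k, i) # v) =
     wins_within g S (edge \<omega>') (colour \<omega>') W n b v"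
  by (induction n arbitrary: b v) (simp_all add: moves_subtree)

end

text \<open>
  The event whose probability is studied. The colour of the root is a separate argument, so that
  the event depends on the offspring vectors alone.
\<close>

definition root_win ::
    "game \<Rightarrow> ('m \<Rightarrow> 'm set) \<Rightarrow> player \<Rightarrow> nat \<Rightarrow> player \<Rightarrow> 'm \<Rightarrow> ('m vertex \<times> 'm \<Rightarrow> 'm \<Rightarrow> nat) \<Rightarrow> bool"
  where "root_win g S W n b j f = wins_within g S (edge (j, f)) (colour (j, f)) W n b []"

lemma root_win_0 [simp]: "\<not> root_win g S W 0 b j f"
  by (simp add: root_win_def)

lemma root_win_Suc:
  "root_win g S W (Suc n) b j f \<longleftrightarrow>
     (if \<forall>k\<in>allowed S b j. f ([], j) k = 0 then stuck_win g W b
      else if b = W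
      then \<exists>k\<in>allowed S b j. \<exists>i<f ([], j) k. root_win g S W n (opponent b) k (subtree [(k, i)] f)
      else \<forall>k\<in>allowed S b j. \<forall>i<f ([], j) k. root_win g S W n (opponent b) k (subtree [(k, i)] f))"
proof -
  have sub: "wins_within g S (edge (j, f)) (colour (j, f)) W n (opponent b) [(k, i)] =
        root_win g S W n (opponent b) k (subtree [(k, i)] f)" if "i < f ([], j) k" for k i
    using wins_within_subtree[of i "(j, f)" k] that
    by (simp add: root_win_def offspring_def colour_def)
  have "moves S (edge (j, f)) (colour (j, f)) b [] = {} \<longleftrightarrow> (\<forall>k\<in>allowed S b j. f ([], j) k = 0)"
    by (fastforce simp: moves_root)
  moreover have "(\<exists>w\<in>moves S (edge (j, f)) (colour (j, f)) b []. R w)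
        \<longleftrightarrow> (\<exists>k\<in>allowed S b j. \<exists>i<f ([], j) k. R [(k, i)])"
      "(\<forall>w\<in>moves S (edge (j, f)) (colour (j, f)) b []. R w)
        \<longleftrightarrow> (\<forall>k\<in>allowed S b j. \<forall>i<f ([], j) k. R [(k, i)])" for R
    by (auto simp: moves_root)
  ultimately show ?thesis
    unfolding root_win_def[of g S W "Suc n"] wins_within.simps
    by (simp only: sub cong: conj_cong imp_cong)
qed

lemma wins_root_iff:
  fixes \<omega> :: "'m::finite gw_sample"
  assumes "\<not> won_by g (\<lambda>_. False) W"
  shows "wins g S (edge \<omega>) (colour \<omega>) [] b W \<longleftrightarrow> (\<exists>n. root_win g S W n b (fst \<omega>) (snd \<omega>))"
proof
  assume "wins g S (edge \<omega>) (colour \<omega>) [] b W"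
  from wins_imp_wins_within[OF finite_moves assms this]
  show "\<exists>n. root_win g S W n b (fst \<omega>) (snd \<omega>)" by (simp add: root_win_def)
next
  assume "\<exists>n. root_win g S W n b (fst \<omega>) (snd \<omega>)"
  then obtain n where "root_win g S W n b (fst \<omega>) (snd \<omega>)" ..
  then show "wins g S (edge \<omega>) (colour \<omega>) [] b W"
    unfolding root_win_def prod.collapse by (rule wins_within_imp_wins)
qed

section \<open>Independence of the subtrees of the children of the root\<close>

text \<open>
  The law of the offspring vectors alone, that is, the second factor of the law of the tree.
\<close>

definition offspring_measure ::
    "('m::finite \<Rightarrow> ('m \<Rightarrow> nat) pmf) \<Rightarrow> ('m vertex \<times> 'm \<Rightarrow> 'm \<Rightarrow> nat) measure" where
  "offspring_measure chi = PiM UNIV (\<lambda>x. measure_pmf (chi (snd x)))"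

lemma gw_measure_eq: "gw_measure p chi = measure_pmf p \<Otimes>\<^sub>M offspring_measure chi"
  by (simp add: gw_measure_def offspring_measure_def split_beta')

lemma space_offspring_measure [simp]: "space (offspring_measure chi) = UNIV"
  by (simp add: offspring_measure_def space_PiM PiE_UNIV_domain)

lemma prob_space_offspring_measure: "prob_space (offspring_measure chi)"
  unfolding offspring_measure_def by (intro prob_space_PiM prob_space_measure_pmf)

lemma measurable_offspring [measurable]:
  "(\<lambda>f. f x) \<in> offspring_measure chi \<rightarrow>\<^sub>M count_space UNIV"
proof -
  have "(\<lambda>f. f x) \<in> offspring_measure chi \<rightarrow>\<^sub>M measure_pmf (chi (snd x))"
    unfolding offspring_measure_def by (rule measurable_component_singleton) simp
  then show ?thesis by (simp cong: measurable_cong_sets)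
qed

lemma pred_offspring: "Measurable.pred (offspring_measure chi) (\<lambda>f. P (f x))"
  using measurable_offspring by (rule measurable_compose) simp

lemma pred_no_children: "Measurable.pred (offspring_measure chi) (\<lambda>f. \<forall>k\<in>A. f ([], j) k = 0)"
  by (rule pred_offspring[where P = "\<lambda>N. \<forall>k\<in>A. N k = 0"])

lemma measurable_subtree_PiM:
  assumes "\<And>v i. (u @ v, i) \<in> K"
  shows "subtree u \<in> PiM K (\<lambda>x. measure_pmf (chi (snd x))) \<rightarrow>\<^sub>M offspring_measure chi"
  unfolding offspring_measure_def
proof (rule measurable_PiM_single')
  fix y :: "'a vertex \<times> 'a"
  have "(\<lambda>g. g (u @ fst y, snd y)) \<in> PiM K (\<lambda>x. measure_pmf (chi (snd x)))
      \<rightarrow>\<^sub>M measure_pmf (chi (snd (u @ fst y, snd y)))"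
    using assms by (intro measurable_component_singleton)
  then show "(\<lambda>g. subtree u g y) \<in> PiM K (\<lambda>x. measure_pmf (chi (snd x))) \<rightarrow>\<^sub>M measure_pmf (chi (snd y))"
    by (simp add: subtree_def split_beta')
qed (simp add: PiE_UNIV_domain)

lemma measurable_subtree [measurable]:
  "subtree u \<in> offspring_measure chi \<rightarrow>\<^sub>M offspring_measure chi"
  using measurable_subtree_PiM[of u UNIV] by (simp add: offspring_measure_def)

lemma pred_all_children:
  fixes chi :: "'m::finite \<Rightarrow> ('m \<Rightarrow> nat) pmf"
  assumes "\<And>k. Measurable.pred (offspring_measure chi) (Q k)"
  shows "Measurable.pred (offspring_measure chi) (\<lambda>f. \<forall>k\<in>A. \<forall>i<f ([], j) k. Q k (subtree [(k, i)] f))"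
proof -
  have [measurable]: "Measurable.pred (offspring_measure chi) (\<lambda>f. Q k (subtree u f))" for k u
    using measurable_subtree assms by (rule measurable_compose)
  have [measurable]: "Measurable.pred (offspring_measure chi) (\<lambda>f. i < f ([], j) k)" for i k
    by (rule pred_offspring)
  show ?thesis by (intro pred_intros_finite pred_intros_countable pred_intros_logic; measurable)
qed

text \<open>
  The offspring vectors are independent, with a law that depends on the colour only, and a relabelling
  changes no colour: the subtree at any label is again a Galton-Watson tree.
\<close>

lemma distr_subtree:
  "distr (offspring_measure chi) (offspring_measure chi) (subtree u) = offspring_measure chi"
proof -
  have "inj (\<lambda>x :: 'a vertex \<times> 'a. (u @ fst x, snd x))"
    by (auto simp: inj_on_def)
  from distr_PiM_reindex[OF _ this, of UNIV "\<lambda>x. measure_pmf (chi (snd x))"]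
  show ?thesis
    by (simp add: offspring_measure_def prob_space_measure_pmf subtree_def[abs_def] split_beta' restrict_UNIV)
qed

lemma distr_offspring:
  "distr (offspring_measure chi) (measure_pmf (chi (snd x))) (\<lambda>f. f x) = measure_pmf (chi (snd x))"
proof -
  interpret P: product_prob_space "\<lambda>x. measure_pmf (chi (snd x))" UNIV
    by (intro product_prob_spaceI prob_space_measure_pmf)
  show ?thesis unfolding offspring_measure_def by (rule P.PiM_component) simp
qed

lemma indep_offspring:
  "prob_space.indep_vars (offspring_measure chi) (\<lambda>x. measure_pmf (chi (snd x))) (\<lambda>x f. f x) UNIV"
proof -
  interpret prob_space "offspring_measure chi" by (rule prob_space_offspring_measure)
  show ?thesis
    by (subst indep_vars_iff_distr_eq_PiM)
       (simp_all add: distr_offspring restrict_UNIV,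
        simp_all add: offspring_measure_def measurable_component_singleton distr_id2)
qed

text \<open>
  The root's offspring vector and the subtrees at distinct labels of length one are functions of
  disjoint blocks of coordinates, hence independent. Given the offspring vector \<open>N\<close>, only finitely many
  of these blocks matter.
\<close>

lemma prob_branching:
  fixes chi :: "'m::finite \<Rightarrow> ('m \<Rightarrow> nat) pmf" and Q :: "'m \<Rightarrow> ('m vertex \<times> 'm \<Rightarrow> 'm \<Rightarrow> nat) \<Rightarrow> bool"
  assumes Q [measurable]: "\<And>k. Measurable.pred (offspring_measure chi) (Q k)"
  shows "measure (offspring_measure chi) {f. f ([], j) = N \<and> (\<forall>k\<in>A. \<forall>i<N k. Q k (subtree [(k, i)] f))}
    = pmf (chi j) N * (\<Prod>k\<in>A. measure (offspring_measure chi) {f. Q k f} ^ N k)"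
proof -
  let ?M = "\<lambda>x :: 'm vertex \<times> 'm. measure_pmf (chi (snd x))"
  let ?P = "offspring_measure chi"
  interpret prob_space ?P by (rule prob_space_offspring_measure)
  \<comment> \<open>\<open>None\<close> stands for the root and \<open>Some c\<close> for the subtree at the label \<open>[c]\<close>.\<close>
  define K :: "('m \<times> nat) option \<Rightarrow> ('m vertex \<times> 'm) set"
    where "K x = (case x of None \<Rightarrow> {([], j)} | Some c \<Rightarrow> range (\<lambda>(v, i). (c # v, i)))" for x
  define B :: "('m \<times> nat) option \<Rightarrow> ('m vertex \<times> 'm \<Rightarrow> 'm \<Rightarrow> nat) set"
    where "B x = (case x of None \<Rightarrow> {g \<in> space (PiM (K None) ?M). g ([], j) = N}
      | Some c \<Rightarrow> {g \<in> space (PiM (K (Some c)) ?M). Q (fst c) (subtree [c] g)})" for x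
  define J where "J = insert None (Some ` (SIGMA k:A. {..<N k}))"
  have "disjoint_family_on K UNIV"
    unfolding disjoint_family_on_def by (auto simp: K_def split: option.splits)
  then have ind: "indep_vars (\<lambda>x. PiM (K x) ?M) (\<lambda>x f. restrict f (K x)) UNIV"
    by (intro indep_vars_restrict[OF indep_offspring]) auto
  have sub: "subtree [c] \<in> PiM (K (Some c)) ?M \<rightarrow>\<^sub>M ?P" for c
    by (rule measurable_subtree_PiM) (force simp: K_def)
  have B: "B x \<in> sets (PiM (K x) ?M)" for x
  proof (cases x)
    case None
    have "(\<lambda>g. g ([], j)) \<in> PiM (K None) ?M \<rightarrow>\<^sub>M ?M ([], j)"
      by (rule measurable_component_singleton) (simp add: K_def)
    then have "(\<lambda>g. g ([], j)) -` {N} \<inter> space (PiM (K None) ?M) \<in> sets (PiM (K None) ?M)"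
      by (rule measurable_sets) simp
    then show ?thesis by (simp add: None B_def vimage_def Int_def conj_commute)
  next
    case (Some c)
    have "Measurable.pred (PiM (K (Some c)) ?M) (\<lambda>g. Q (fst c) (subtree [c] g))"
      using sub Q by (rule measurable_compose)
    then show ?thesis by (simp add: Some B_def pred_def)
  qed
  have space_K: "restrict f (K x) \<in> space (PiM (K x) ?M)" for f x
    by (auto simp: space_PiM split_beta)
  have None: "(\<lambda>f. restrict f (K None)) -` B None \<inter> space ?P = {f. f ([], j) = N}"
    using space_K by (auto simp: B_def) (auto simp: K_def)
  have Some: "(\<lambda>f. restrict f (K (Some c))) -` B (Some c) \<inter> space ?P = {f. Q (fst c) (subtree [c] f)}" for c
  proof -
    have "subtree [c] (restrict f (K (Some c))) = subtree [c] f" for f :: "'m vertex \<times> 'm \<Rightarrow> 'm \<Rightarrow> nat"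
      by (auto simp: subtree_def K_def fun_eq_iff)
    then show ?thesis using space_K by (auto simp: B_def)
  qed
  have "(\<Inter>x\<in>J. (\<lambda>f. restrict f (K x)) -` B x \<inter> space ?P)
      = {f. f ([], j) = N} \<inter> (\<Inter>c\<in>(SIGMA k:A. {..<N k}). {f. Q (fst c) (subtree [c] f)})"
    unfolding J_def image_insert image_image None Some by simp
  also have "\<dots> = {f. f ([], j) = N \<and> (\<forall>k\<in>A. \<forall>i<N k. Q k (subtree [(k, i)] f))}"
    by auto
  finally have "prob {f. f ([], j) = N \<and> (\<forall>k\<in>A. \<forall>i<N k. Q k (subtree [(k, i)] f))}
      = prob (\<Inter>x\<in>J. (\<lambda>f. restrict f (K x)) -` B x \<inter> space ?P)"
    by simp
  also have "\<dots> = (\<Prod>x\<in>J. prob ((\<lambda>f. restrict f (K x)) -` B x \<inter> space ?P))"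
    using B by (intro indep_varsD[OF ind]) (auto simp: J_def)
  also have "\<dots> = prob {f. f ([], j) = N} * (\<Prod>c\<in>(SIGMA k:A. {..<N k}). prob {f. Q (fst c) (subtree [c] f)})"
    by (simp add: J_def None Some prod.reindex del: space_offspring_measure)
  also have "prob {f. f ([], j) = N} = pmf (chi j) N"
  proof -
    have "measure (chi j) {N} = measure (distr ?P (chi j) (\<lambda>f. f ([], j))) {N}"
      using distr_offspring[of chi "([], j)"] by simp
    also have "\<dots> = prob {f. f ([], j) = N}"
      by (subst measure_distr) (auto simp: vimage_def cong: measurable_cong_sets)
    finally show ?thesis by (simp add: measure_pmf_single)
  qed
  also have "(\<Prod>c\<in>(SIGMA k:A. {..<N k}). prob {f. Q (fst c) (subtree [c] f)})
      = (\<Prod>c\<in>(SIGMA k:A. {..<N k}). prob {f. Q (fst c) f})"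
  proof (rule prod.cong)
    fix c
    have "prob {f. Q (fst c) f} = measure (distr ?P ?P (subtree [c])) {f. Q (fst c) f}"
      by (simp add: distr_subtree)
    also have "\<dots> = prob {f. Q (fst c) (subtree [c] f)}"
      using Q[of "fst c"] by (subst measure_distr) (auto simp: vimage_def pred_def)
    finally show "prob {f. Q (fst c) (subtree [c] f)} = prob {f. Q (fst c) f}" ..
  qed simp
  also have "\<dots> = (\<Prod>k\<in>A. prob {f. Q k f} ^ N k)"
    using prod.Sigma[of A "\<lambda>k. {..<N k}" "\<lambda>k i. prob {f. Q k f}"] by (simp add: split_beta')
  finally show ?thesis .
qed

text \<open>
  The colour of the root is independent of the offspring vectors, so conditioning on it amounts to
  fixing it. This covers null colours as well, where the conditional law is the law of the
  tree with that colour at its root.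
\<close>

lemma prob_given_root_eq:
  assumes B: "\<And>i. Measurable.pred (offspring_measure chi) (B i)"
    and A: "\<And>\<omega>. A \<omega> \<longleftrightarrow> B (fst \<omega>) (snd \<omega>)"
  shows "prob_given_root p chi j A = measure (offspring_measure chi) {f. B j f}"
proof -
  let ?P = "offspring_measure chi"
  interpret P: prob_space ?P by (rule prob_space_offspring_measure)
  have slice: "measure (gw_measure q chi) ({i} \<times> {f. C f}) = pmf q i * measure ?P {f. C f}"
    if "Measurable.pred ?P C" for q i C
  proof -
    have "emeasure (measure_pmf q \<Otimes>\<^sub>M ?P) ({i} \<times> {f. C f}) = emeasure q {i} * emeasure ?P {f. C f}"
      using that by (intro P.emeasure_pair_measure_Times) (auto simp: pred_def)
    then show ?thesis
      by (simp add: gw_measure_eq measure_def emeasure_pmf_single enn2real_mult)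
  qed
  have space: "space (gw_measure q chi) = UNIV" for q
    by (simp add: gw_measure_eq space_pair_measure)
  show ?thesis
  proof (cases "pmf p j > 0")
    case True
    have "{\<omega>. A \<omega> \<and> colour \<omega> [] = j} = {j} \<times> {f. B j f}" "{\<omega>. colour \<omega> [] = j} = {j} \<times> {f. True}"
      by (auto simp: A colour_def)
    then show ?thesis
      using True B slice[of "\<lambda>_. True" p j] P.prob_space
      by (simp add: prob_given_root_def cond_prob_def space slice)
  next
    case False
    interpret R: prob_space "gw_measure (return_pmf j) chi"
      unfolding gw_measure_eq
      by (intro prob_space_pair prob_space_measure_pmf prob_space_offspring_measure)
    have "{\<omega>. A \<omega>} = (\<Union>i. {i} \<times> {f. B i f})" by (auto simp: A)
    moreover have "R.prob (\<Union>i. {i} \<times> {f. B i f}) = (\<Sum>i\<in>UNIV. R.prob ({i} \<times> {f. B i f}))"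
      using B by (intro R.finite_measure_finite_Union)
        (auto simp: gw_measure_eq disjoint_family_on_def pred_def)
    ultimately show ?thesis
      using False B by (simp add: prob_given_root_def space slice indicator_def if_distrib cong: if_cong)
  qed
qed

section \<open>Generating functions\<close>

text \<open>
  The marginal law lives on functions that are undefined off \<open>A\<close>, whereas the expectation is taken with
  respect to the full offspring law; the integrand only looks at colours in \<open>A\<close>.
\<close>

lemma G_eq_expectation:
  fixes chi :: "'m::finite \<Rightarrow> ('m \<Rightarrow> nat) pmf"
  assumes x: "x \<in> cube"
  shows "G chi j A x = measure_pmf.expectation (chi j) (\<lambda>n. \<Prod>k\<in>A. x k ^ n k)"
proof -
  let ?w = "\<lambda>n. \<Prod>k\<in>A. x k ^ n k"
  have bound: "0 \<le> ?w n" "?w n \<le> 1" for n :: "'m \<Rightarrow> nat"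
    using x by (auto simp: cube_def Pi_iff intro!: prod_nonneg prod_le_1 power_le_one)
  have "measure_pmf.expectation (chi j) ?w = measure_pmf.expectation (marginal chi j A) ?w"
    by (simp add: marginal_def cong: prod.cong)
  also have "\<dots> = (\<Sum>\<^sub>an\<in>UNIV. pmf (marginal chi j A) n * ?w n)"
    by (rule pmf_expectation_eq_infsetsum)
  also have "\<dots> = (\<Sum>\<^sub>\<infinity>n\<in>UNIV. pmf (marginal chi j A) n * ?w n)"
  proof (rule infsetsum_infsum, rule abs_summable_on_comparison_test'[OF pmf_abs_summable])
    fix n show "norm (pmf (marginal chi j A) n * ?w n) \<le> pmf (marginal chi j A) n"
      using bound[of n] mult_left_le[of "?w n" "pmf (marginal chi j A) n"] by (simp add: abs_mult)
  qed
  also have "\<dots> = G chi j A x"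
    unfolding G_def
  proof (rule infsum_cong_neutral)
    fix n assume "n \<in> UNIV - (A \<rightarrow>\<^sub>E (UNIV :: nat set))"
    then have "n \<notin> set_pmf (marginal chi j A)" by (auto simp: marginal_def PiE_def)
    then show "pmf (marginal chi j A) n * ?w n = 0" by (simp add: set_pmf_iff)
  qed (auto simp: mult.commute)
  finally show ?thesis ..
qed

lemma G_mono:
  assumes "x \<in> cube" "y \<in> cube" "x \<le> y"
  shows "G chi j A x \<le> G chi j A y"
proof -
  have int: "integrable (measure_pmf (chi j)) (\<lambda>n. \<Prod>k\<in>A. z k ^ n k)" if "z \<in> cube" for z
    using that by (intro measure_pmf.integrable_const_bound[where B = 1])
      (auto simp: cube_def Pi_iff abs_prod power_abs intro!: prod_le_1 power_le_one)
  show ?thesis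
    using assms by (auto simp: G_eq_expectation cube_def Pi_iff le_fun_def
        intro!: integral_mono int prod_mono power_mono)
qed

lemma G_le_1: "x \<in> cube \<Longrightarrow> G chi j A x \<le> 1"
  using G_mono[of x "\<lambda>_. 1" chi j A] G_eq_expectation[of "\<lambda>_. 1" chi j A]
  by (auto simp: cube_def Pi_iff le_fun_def)

lemma G_nonneg: "x \<in> cube \<Longrightarrow> 0 \<le> G chi j A x"
  by (auto simp: G_eq_expectation cube_def Pi_iff intro!: integral_nonneg_AE prod_nonneg)

lemma G_zero_le: "x \<in> cube \<Longrightarrow> G chi j A (\<lambda>_. 0) \<le> G chi j A x"
  by (rule G_mono) (auto simp: cube_def Pi_iff le_fun_def)

lemma tendsto_G:
  assumes "\<And>n. X n \<in> cube" "x \<in> cube" and lim: "\<And>k. (\<lambda>n. X n k) \<longlonglongrightarrow> x k"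
  shows "(\<lambda>n. G chi j A (X n)) \<longlonglongrightarrow> G chi j A x"
  unfolding G_eq_expectation[OF assms(1)] G_eq_expectation[OF assms(2)]
proof (rule integral_dominated_convergence[where w = "\<lambda>_. 1"])
  show "AE N in measure_pmf (chi j). norm (\<Prod>k\<in>A. X n k ^ N k) \<le> 1" for n
    using assms(1)[of n]
    by (auto simp: cube_def Pi_iff abs_prod power_abs intro!: prod_le_1 power_le_one)
qed (auto intro!: tendsto_intros lim)

lemma one_minus_cube: "x \<in> cube \<Longrightarrow> (\<lambda>k. 1 - x k) \<in> cube"
  by (auto simp: cube_def Pi_iff)

lemma zero_cube: "(\<lambda>_. 0) \<in> cube"
  by (simp add: cube_def)

text \<open>
  Summation of the branching identity over the offspring vectors of the root.
\<close>

lemma prob_all_children: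
  fixes chi :: "'m::finite \<Rightarrow> ('m \<Rightarrow> nat) pmf" and Q :: "'m \<Rightarrow> ('m vertex \<times> 'm \<Rightarrow> 'm \<Rightarrow> nat) \<Rightarrow> bool"
  assumes Q [measurable]: "\<And>k. Measurable.pred (offspring_measure chi) (Q k)"
  shows "measure (offspring_measure chi) {f. \<forall>k\<in>A. \<forall>i<f ([], j) k. Q k (subtree [(k, i)] f)}
    = G chi j A (\<lambda>k. measure (offspring_measure chi) {f. Q k f})"
proof -
  interpret prob_space "offspring_measure chi" by (rule prob_space_offspring_measure)
  let ?F = "\<lambda>N. {f. f ([], j) = N \<and> (\<forall>k\<in>A. \<forall>i<N k. Q k (subtree [(k, i)] f))}"
  have F: "?F N \<in> events" for N
  proof -
    have "Measurable.pred (offspring_measure chi) (\<lambda>f. f ([], j) = N \<and> (\<forall>k\<in>A. \<forall>i<N k. Q k (subtree [(k, i)] f)))"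
      by measurable
    then show ?thesis by (simp add: pred_def)
  qed
  have "emeasure (offspring_measure chi) (\<Union>N. ?F N)
      = (\<integral>\<^sup>+N. emeasure (offspring_measure chi) (?F N) \<partial>count_space UNIV)"
    using F by (intro emeasure_UN_countable) (auto simp: disjoint_family_on_def)
  also have "\<dots> = (\<integral>\<^sup>+N. ennreal (\<Prod>k\<in>A. prob {f. Q k f} ^ N k) \<partial>measure_pmf (chi j))"
    by (simp add: emeasure_eq_measure prob_branching Q nn_integral_measure_pmf ennreal_mult'[symmetric])
  also have "\<dots> = ennreal (measure_pmf.expectation (chi j) (\<lambda>N. \<Prod>k\<in>A. prob {f. Q k f} ^ N k))"
    by (intro nn_integral_eq_integral measure_pmf.integrable_const_bound[where B = 1])
       (auto simp: abs_prod power_abs intro!: prod_nonneg prod_le_1 power_le_one)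
  also have "\<dots> = ennreal (G chi j A (\<lambda>k. prob {f. Q k f}))"
    by (subst G_eq_expectation) (auto simp: cube_def)
  also have "(\<Union>N. ?F N) = {f. \<forall>k\<in>A. \<forall>i<f ([], j) k. Q k (subtree [(k, i)] f)}" by auto
  finally show ?thesis
    using G_eq_expectation[of "\<lambda>k. prob {f. Q k f}" chi j A]
    by (simp add: emeasure_eq_measure cube_def prod_nonneg integral_nonneg_AE)
qed

text \<open>
  A root none of whose children satisfies the impossible property has no children; the
  formula relies on the convention \<open>0 ^ 0 = 1\<close>.
\<close>

lemma prob_no_children:
  "measure (offspring_measure chi) {f. \<forall>k\<in>A. f ([], j) k = 0} = G chi j A (\<lambda>_. 0)"
proof -
  have "{f. \<forall>k\<in>A. \<forall>i<f ([], j) k. False} = {f :: 'a vertex \<times> 'a \<Rightarrow> 'a \<Rightarrow> nat. \<forall>k\<in>A. f ([], j) k = 0}"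
    by auto
  then show ?thesis using prob_all_children[where chi = chi and Q = "\<lambda>_ _. False" and A = A and j = j] by simp
qed

lemma has_child_iff: "(\<exists>v. edge \<omega> [] v \<and> colour \<omega> v = k) \<longleftrightarrow> snd \<omega> ([], fst \<omega>) k \<noteq> 0"
proof
  assume "snd \<omega> ([], fst \<omega>) k \<noteq> 0"
  then have "edge \<omega> [] [(k, 0)] \<and> colour \<omega> [(k, 0)] = k"
    by (simp add: edge_def colour_def offspring_def vertices.root)
  then show "\<exists>v. edge \<omega> [] v \<and> colour \<omega> v = k" ..
qed (auto simp: edge_def colour_def offspring_def)

lemma \<alpha>_eq: "\<alpha> p chi S j = G chi j (S j) (\<lambda>_. 0)"
  unfolding \<alpha>_def prob_no_children[symmetric]
  by (rule prob_given_root_eq[where B = "\<lambda>i f. \<forall>k\<in>S j. f ([], i) k = 0"])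
     (rule pred_no_children, simp add: has_child_iff)

lemma \<beta>_eq: "\<beta> p chi S j = G chi j (- S j) (\<lambda>_. 0)"
  unfolding \<beta>_def prob_no_children[symmetric]
  by (rule prob_given_root_eq[where B = "\<lambda>i f. \<forall>k\<in>- S j. f ([], i) k = 0"])
     (rule pred_no_children, simp add: has_child_iff)

section \<open>The recursion for the outcome probabilities\<close>

text \<open>
  One round of the game, in terms of probabilities: \<open>x k\<close> is the probability that \<open>W\<close> wins from
  a child of colour \<open>k\<close>. The value \<open>G\<close> at \<open>0\<close> is the probability that \<open>b\<close> cannot move.
  When \<open>W\<close> moves, she wins if not all children are bad; this excludes a root without permissible
  children, which is added if the rules give her the victory there. When her opponent moves, she wins if all
  children are good; this includes a root without permissible children, which is subtracted if the
  rules deny her the victory there.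
\<close>

definition outcome_map ::
    "game \<Rightarrow> ('m::finite \<Rightarrow> ('m \<Rightarrow> nat) pmf) \<Rightarrow> ('m \<Rightarrow> 'm set) \<Rightarrow> player \<Rightarrow> player \<Rightarrow> ('m \<Rightarrow> real) \<Rightarrow> 'm \<Rightarrow> real"
  where
  "outcome_map g chi S W b x j =
     (if b = W
      then (if stuck_win g W b then G chi j (allowed S b j) (\<lambda>_. 0) else 0)
             + 1 - G chi j (allowed S b j) (\<lambda>k. 1 - x k)
      else G chi j (allowed S b j) x
             - (if stuck_win g W b then 0 else G chi j (allowed S b j) (\<lambda>_. 0)))"

lemma outcome_map_cube:
  assumes "x \<in> cube"
  shows "outcome_map g chi S W b x \<in> cube"
proof -
  have "outcome_map g chi S W b x j \<in> {0..1}" for j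
    using assms one_minus_cube[OF assms] G_nonneg[of "\<lambda>_. 0" chi j "allowed S b j"]
      G_le_1[of x chi j "allowed S b j"] G_le_1[of "\<lambda>k. 1 - x k" chi j "allowed S b j"]
      G_zero_le[of x chi j "allowed S b j"] G_zero_le[of "\<lambda>k. 1 - x k" chi j "allowed S b j"]
    by (auto simp: outcome_map_def zero_cube)
  then show ?thesis by (simp add: cube_def)
qed

lemma outcome_map_mono:
  assumes "x \<in> cube" "y \<in> cube" "x \<le> y"
  shows "outcome_map g chi S W b x \<le> outcome_map g chi S W b y"
proof -
  have "(\<lambda>k. 1 - y k) \<le> (\<lambda>k. 1 - x k)" using assms(3) by (auto simp: le_fun_def)
  then show ?thesis
    using G_mono[OF assms] G_mono[OF one_minus_cube one_minus_cube, OF assms(2,1)]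
    by (auto simp: le_fun_def outcome_map_def)
qed

lemma tendsto_outcome_map:
  assumes "\<And>n. X n \<in> cube" "x \<in> cube" "\<And>k. (\<lambda>n. X n k) \<longlonglongrightarrow> x k"
  shows "(\<lambda>n. outcome_map g chi S W b (X n) j) \<longlonglongrightarrow> outcome_map g chi S W b x j"
  using assms unfolding outcome_map_def
  by (auto intro!: tendsto_intros tendsto_G one_minus_cube)

text \<open>
  The existential quantifiers are rewritten as negated universal ones, so that both kinds of moves are
  covered by \<open>pred_all_children\<close>.
\<close>

lemma measurable_root_win [measurable]:
  "Measurable.pred (offspring_measure chi) (root_win g S W n b j)"
proof (induction n arbitrary: b j)
  case (Suc n)
  let ?P = "offspring_measure chi" and ?Q = "\<lambda>k f. root_win g S W n (opponent b) k f"
  have Z: "Measurable.pred ?P (\<lambda>f. \<forall>k\<in>allowed S b j. f ([], j) k = 0)"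
    by (rule pred_no_children)
  have all:
    "Measurable.pred ?P (\<lambda>f. \<forall>k\<in>allowed S b j. \<forall>i<f ([], j) k. ?Q k (subtree [(k, i)] f))"
    "Measurable.pred ?P (\<lambda>f. \<forall>k\<in>allowed S b j. \<forall>i<f ([], j) k. \<not> ?Q k (subtree [(k, i)] f))"
    using Suc.IH by (auto intro!: pred_all_children[where Q = ?Q] pred_all_children[where Q = "\<lambda>k f. \<not> ?Q k f"])
  have ex: "(\<exists>k\<in>A. \<exists>i<N k. R k i) \<longleftrightarrow> \<not> (\<forall>k\<in>A. \<forall>i<N k. \<not> R k i)"
    for A :: "'a set" and N :: "'a \<Rightarrow> nat" and R by blast
  show ?case
    unfolding root_win_Suc[abs_def] ex if_bool_eq_disj
    by (intro pred_intros_logic measurable_const Z all) simp_all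
next
  case 0
  have "root_win g S W 0 b j = (\<lambda>_. False)" by (rule ext) simp
  then show ?case by simp
qed

definition prob_within ::
    "game \<Rightarrow> ('m::finite \<Rightarrow> ('m \<Rightarrow> nat) pmf) \<Rightarrow> ('m \<Rightarrow> 'm set) \<Rightarrow> player \<Rightarrow> nat \<Rightarrow> player \<Rightarrow> 'm \<Rightarrow> real"
  where "prob_within g chi S W n b j = measure (offspring_measure chi) {f. root_win g S W n b j f}"

definition prob_eventually ::
    "game \<Rightarrow> ('m::finite \<Rightarrow> ('m \<Rightarrow> nat) pmf) \<Rightarrow> ('m \<Rightarrow> 'm set) \<Rightarrow> player \<Rightarrow> player \<Rightarrow> 'm \<Rightarrow> real"
  where "prob_eventually g chi S W b j = measure (offspring_measure chi) {f. \<exists>n. root_win g S W n b j f}"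

lemma prob_within_cube: "prob_within g chi S W n b \<in> cube"
  and prob_eventually_cube: "prob_eventually g chi S W b \<in> cube"
proof -
  interpret prob_space "offspring_measure chi" by (rule prob_space_offspring_measure)
  show "prob_within g chi S W n b \<in> cube" "prob_eventually g chi S W b \<in> cube"
    by (auto simp: cube_def prob_within_def prob_eventually_def)
qed

lemma prob_within_Suc:
  "prob_within g chi S W (Suc n) b = outcome_map g chi S W b (prob_within g chi S W n (opponent b))"
proof
  fix j
  let ?P = "offspring_measure chi" and ?A = "allowed S b j"
  interpret prob_space ?P by (rule prob_space_offspring_measure)
  let ?Q = "\<lambda>k f. root_win g S W n (opponent b) k f"
  let ?Z = "{f :: 'a vertex \<times> 'a \<Rightarrow> 'a \<Rightarrow> nat. \<forall>k\<in>?A. f ([], j) k = 0}"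
  let ?all = "\<lambda>Q :: 'a \<Rightarrow> _ \<Rightarrow> bool. {f. \<forall>k\<in>?A. \<forall>i<f ([], j) k. Q k (subtree [(k, i)] f)}"
  have Z: "?Z \<in> events"
    using pred_no_children[where chi = chi and A = ?A and j = j] by (simp add: pred_def)
  have all: "?all Q \<in> events" if "\<And>k. Measurable.pred ?P (Q k)" for Q
    using pred_all_children[where Q = Q, OF that] by (simp add: pred_def)
  note Q = measurable_root_win[where chi = chi and n = n and b = "opponent b" and g = g and S = S and W = W]
  show "prob_within g chi S W (Suc n) b j
      = outcome_map g chi S W b (prob_within g chi S W n (opponent b)) j"
  proof (cases "b = W")
    case True
    have notQ: "Measurable.pred ?P (\<lambda>f. \<not> ?Q k f)" for k by measurable
    have neg: "prob {f. \<not> ?Q k f} = 1 - prob_within g chi S W n (opponent b) k" for k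
      using prob_compl[of "{f. ?Q k f}"] Q[of k]
      by (simp add: prob_within_def pred_def Compl_eq_Diff_UNIV[symmetric] Collect_neg_eq[symmetric])
    \<comment> \<open>All permissible children are bad for \<open>W\<close>; this contains the event \<open>?Z\<close> that there are none.\<close>
    let ?C = "?all (\<lambda>k f. \<not> ?Q k f)"
    have "{f. root_win g S W (Suc n) b j f} = (if stuck_win g W b then ?Z else {}) \<union> (UNIV - ?C)"
      using True by (fastforce simp: root_win_Suc split: if_splits)
    moreover have "prob ((if stuck_win g W b then ?Z else {}) \<union> (UNIV - ?C))
        = prob (if stuck_win g W b then ?Z else {}) + prob (UNIV - ?C)"
      using Z all[OF notQ] sets.compl_sets[OF all[OF notQ]]
      by (intro finite_measure_Union) (auto split: if_splits)
    moreover have "prob (UNIV - ?C) = 1 - G chi j ?A (\<lambda>k. 1 - prob_within g chi S W n (opponent b) k)"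
      using prob_compl[OF all[OF notQ]] prob_all_children[OF notQ, of ?A j] by (simp add: neg)
    ultimately show ?thesis
      using True by (simp add: prob_within_def[of g chi S W "Suc n"] outcome_map_def prob_no_children)
  next
    case False
    \<comment> \<open>Here \<open>?Z\<close> is contained in the event that all permissible children are good.\<close>
    have "{f. root_win g S W (Suc n) b j f} = ?all ?Q - (if stuck_win g W b then {} else ?Z)"
      using False by (auto simp: root_win_Suc)
    moreover have "prob (?all ?Q - (if stuck_win g W b then {} else ?Z))
        = prob (?all ?Q) - prob (if stuck_win g W b then {} else ?Z)"
      using Z by (intro finite_measure_Diff all Q) auto
    moreover have "prob (?all ?Q) = G chi j ?A (prob_within g chi S W n (opponent b))"
      using prob_all_children[OF Q, of ?A j] by (simp add: prob_within_def[abs_def])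
    ultimately show ?thesis
      using False by (simp add: prob_within_def[of g chi S W "Suc n"] outcome_map_def prob_no_children)
  qed
qed

lemma prob_within_tendsto:
  "(\<lambda>n. prob_within g chi S W n b j) \<longlonglongrightarrow> prob_eventually g chi S W b j"
proof -
  interpret prob_space "offspring_measure chi" by (rule prob_space_offspring_measure)
  have "(\<lambda>n. prob {f. root_win g S W n b j f}) \<longlonglongrightarrow> prob (\<Union>n. {f. root_win g S W n b j f})"
  proof (rule finite_Lim_measure_incseq)
    show "range (\<lambda>n. {f. root_win g S W n b j f}) \<subseteq> events"
      using measurable_root_win[where chi = chi and b = b and g = g and S = S and W = W and j = j] by (auto simp: pred_def)
    show "incseq (\<lambda>n. {f. root_win g S W n b j f})"
      using wins_within_mono by (fastforce simp: incseq_def root_win_def)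
  qed
  moreover have "(\<Union>n. {f. root_win g S W n b j f}) = {f. \<exists>n. root_win g S W n b j f}" by auto
  ultimately show ?thesis by (simp add: prob_within_def prob_eventually_def)
qed

section \<open>Extremal fixed points\<close>

text \<open>
  Passage to the limit in \<open>prob_within_Suc\<close>, by continuity of the generating functions.
\<close>

lemma prob_eventually_fixed:
  "prob_eventually g chi S W b = outcome_map g chi S W b (prob_eventually g chi S W (opponent b))"
proof
  fix j
  have "(\<lambda>n. prob_within g chi S W (Suc n) b j) \<longlonglongrightarrow> prob_eventually g chi S W b j"
    using prob_within_tendsto by (rule LIMSEQ_Suc)
  moreover have "(\<lambda>n. prob_within g chi S W (Suc n) b j)
      \<longlonglongrightarrow> outcome_map g chi S W b (prob_eventually g chi S W (opponent b)) j"
    unfolding prob_within_Suc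
    by (intro tendsto_outcome_map prob_within_cube prob_eventually_cube prob_within_tendsto)
  ultimately show "prob_eventually g chi S W b j
      = outcome_map g chi S W b (prob_eventually g chi S W (opponent b)) j"
    by (rule LIMSEQ_unique)
qed

text \<open>
  Any fixed point \<open>y\<close> yields a pair \<open>(y, T\<^sub>b\<^sub>' y)\<close>, which dominates the pair of probabilities of winning
  within \<open>n\<close> rounds, for the two choices of the player who starts, for each \<open>n\<close>: it
  does so for \<open>n = 0\<close>, and the maps are monotone.
\<close>

lemma is_min_FP_prob_eventually:
  "is_min_FP (\<lambda>x. outcome_map g chi S W b (outcome_map g chi S W (opponent b) x))
     (prob_eventually g chi S W b)"
  unfolding is_min_FP_def
proof (intro conjI ballI)
  let ?T = "outcome_map g chi S W" and ?q = "prob_within g chi S W"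
  show "prob_eventually g chi S W b \<in> FP (\<lambda>x. ?T b (?T (opponent b) x))"
    using prob_eventually_fixed[of g chi S W b, symmetric]
      prob_eventually_fixed[of g chi S W "opponent b", symmetric]
    by (simp add: FP_def prob_eventually_cube)
  fix y assume "y \<in> FP (\<lambda>x. ?T b (?T (opponent b) x))"
  then have y: "y \<in> cube" "?T b (?T (opponent b) y) = y" by (auto simp: FP_def)
  have "?q n b \<le> y \<and> ?q n (opponent b) \<le> ?T (opponent b) y" for n
  proof (induction n)
    case 0
    have "?q 0 c = (\<lambda>_. 0)" for c by (simp add: prob_within_def fun_eq_iff)
    then show ?case using y(1) outcome_map_cube[OF y(1), of g chi S W "opponent b"]
      by (auto simp: le_fun_def cube_def Pi_iff)
  next
    case (Suc n)
    then show ?case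
      using outcome_map_mono[of "?q n (opponent b)" "?T (opponent b) y" g chi S W b]
        outcome_map_mono[of "?q n b" y g chi S W "opponent b"]
      by (simp add: prob_within_Suc prob_within_cube outcome_map_cube y)
  qed
  note below = this
  show "prob_eventually g chi S W b \<le> y"
    unfolding le_fun_def
  proof (intro allI)
    fix j
    have "\<forall>n. prob_within g chi S W n b j \<le> y j"
      using below by (auto simp: le_fun_def)
    then show "prob_eventually g chi S W b j \<le> y j"
      by (intro LIMSEQ_le_const2[OF prob_within_tendsto]) blast
  qed
qed

lemma is_max_FP_reflect:
  assumes "is_min_FP T q" and "\<And>x. F x = (\<lambda>j. 1 - T (\<lambda>k. 1 - x k) j)"
  shows "is_max_FP F (\<lambda>j. 1 - q j)"
  unfolding is_max_FP_def
proof (intro conjI ballI)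
  have q: "q \<in> cube" "T q = q" and least: "\<And>y. y \<in> cube \<Longrightarrow> T y = y \<Longrightarrow> q \<le> y"
    using assms(1) by (auto simp: is_min_FP_def FP_def)
  show "(\<lambda>j. 1 - q j) \<in> FP F" by (simp add: FP_def assms(2) q one_minus_cube)
  fix y assume "y \<in> FP F"
  then have y: "y \<in> cube" "\<And>j. 1 - T (\<lambda>k. 1 - y k) j = y j"
    by (auto simp: FP_def assms(2) fun_eq_iff)
  have "T (\<lambda>k. 1 - y k) j = 1 - y j" for j using y(2)[of j] by linarith
  then have "q \<le> (\<lambda>k. 1 - y k)" by (intro least one_minus_cube y(1)) (simp add: fun_eq_iff)
  then show "y \<le> (\<lambda>j. 1 - q j)" by (auto simp: le_fun_def algebra_simps)
qed

section \<open>The outcome probabilities of the three games\<close>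

lemma prob_given_root_wins:
  assumes "\<not> won_by g (\<lambda>_. False) W"
  shows "prob_given_root p chi j (\<lambda>\<omega>. wins g S (edge \<omega>) (colour \<omega>) [] b W)
    = prob_eventually g chi S W b j"
  unfolding prob_eventually_def
  by (rule prob_given_root_eq[where B = "\<lambda>i f. \<exists>n. root_win g S W n b i f"])
     (intro pred_intros_countable measurable_root_win, rule wins_root_iff[OF assms])

text \<open>
  The first hypothesis holds for every player of every game, except for Escaper.
\<close>

lemma win_prob_is_min_FP:
  assumes "\<not> won_by g (\<lambda>_. False) a"
    and "\<And>x j. F x j = outcome_map g chi S a a (outcome_map g chi S a (opponent a) x) j"
  shows "F \<in> cube \<rightarrow> cube \<and> is_min_FP F (win_prob g p chi S a)"
proof -
  have "F = (\<lambda>x. outcome_map g chi S a a (outcome_map g chi S a (opponent a) x))"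
    using assms(2) by (intro ext)
  moreover have "win_prob g p chi S a = prob_eventually g chi S a a"
    by (rule ext) (simp add: win_prob_def prob_given_root_wins assms(1))
  ultimately show ?thesis
    using is_min_FP_prob_eventually[of g chi S a a] by (simp add: Pi_iff outcome_map_cube)
qed

text \<open>
  A loss of the player who moves first is a victory of her opponent, which is described by a
  least fixed point; reflection turns it into a greatest one.
\<close>

lemma loss_prob_is_max_FP:
  assumes "\<not> won_by g (\<lambda>_. False) (opponent a)"
    and "\<And>x j. F x j = 1 - outcome_map g chi S (opponent a) a
                 (outcome_map g chi S (opponent a) (opponent a) (\<lambda>k. 1 - x k)) j"
  shows "F \<in> cube \<rightarrow> cube \<and> (\<exists>z. is_max_FP F z \<and> loss_prob g p chi S a = (\<lambda>j. 1 - z j))"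
proof -
  let ?T = "outcome_map g chi S (opponent a)" and ?q = "prob_eventually g chi S (opponent a) a"
  have F: "F x = (\<lambda>j. 1 - ?T a (?T (opponent a) (\<lambda>k. 1 - x k)) j)" for x
    using assms(2) by (intro ext)
  have "loss_prob g p chi S a = ?q"
    by (rule ext) (simp add: loss_prob_def loses_def prob_given_root_wins assms(1))
  moreover have "is_max_FP F (\<lambda>j. 1 - ?q j)"
    using is_min_FP_prob_eventually[of g chi S "opponent a" a] F by (rule is_max_FP_reflect)
  moreover have "F \<in> cube \<rightarrow> cube"
    by (simp add: Pi_iff F one_minus_cube outcome_map_cube)
  ultimately have "F \<in> cube \<rightarrow> cube
      \<and> is_max_FP F (\<lambda>j. 1 - ?q j) \<and> loss_prob g p chi S a = (\<lambda>j. 1 - (1 - ?q j))"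
    by simp
  then show ?thesis by blast
qed

text \<open>
  The arithmetical rules bring sums of three terms into the form \<open>a + b - c\<close>, in which both the maps of
  the theorem and the composed outcome maps end up.
\<close>

lemmas outcome_map_unfolds = outcome_map_def[abs_def] stuck_win_def allowed_def \<alpha>_eq \<beta>_eq
  F_N_def F_N'_def F_M_def F_M'_def F_E_def F_E'_def diff_add_eq diff_diff_eq2 add_diff_eq add.commute

theorem theorem1p3:
  fixes p :: "'m::finite pmf"
    and chi :: "'m \<Rightarrow> ('m \<Rightarrow> nat) pmf"
    and S :: "'m \<Rightarrow> 'm set"
  assumes "\<And>j. S j \<noteq> {}" and "\<And>j. S j \<noteq> UNIV"
  shows
    "(F_N chi S \<in> cube \<rightarrow> cube \<and> F_N' chi S \<in> cube \<rightarrow> cube \<and>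
     is_min_FP (F_N chi S) (nw p chi S P1) \<and>
     (\<exists>z. is_max_FP (F_N chi S) z \<and> nl p chi S P1 = (\<lambda>j. 1 - z j)) \<and>
     is_min_FP (F_N' chi S) (nw p chi S P2) \<and>
     (\<exists>z. is_max_FP (F_N' chi S) z \<and> nl p chi S P2 = (\<lambda>j. 1 - z j))) \<and>
     (F_M p chi S \<in> cube \<rightarrow> cube \<and> F_M' p chi S \<in> cube \<rightarrow> cube \<and>
     is_min_FP (F_M p chi S) (mw p chi S P1) \<and>
     (\<exists>z. is_max_FP (F_M p chi S) z \<and> ml p chi S P1 = (\<lambda>j. 1 - z j)) \<and>
     is_min_FP (F_M' p chi S) (mw p chi S P2) \<and>
     (\<exists>z. is_max_FP (F_M' p chi S) z \<and> ml p chi S P2 = (\<lambda>j. 1 - z j))) \<and>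
     (F_E p chi S \<in> cube \<rightarrow> cube \<and> F_E' p chi S \<in> cube \<rightarrow> cube \<and>
     is_min_FP (F_E p chi S) (esw p chi S) \<and>
     (\<exists>z. is_max_FP (F_E' p chi S) z \<and> eel p chi S = (\<lambda>j. 1 - z j)))"
proof -
  have "F_N chi S \<in> cube \<rightarrow> cube \<and> is_min_FP (F_N chi S) (nw p chi S P1)"
    "F_N' chi S \<in> cube \<rightarrow> cube \<and> is_min_FP (F_N' chi S) (nw p chi S P2)"
    "F_M p chi S \<in> cube \<rightarrow> cube \<and> is_min_FP (F_M p chi S) (mw p chi S P1)"
    "F_M' p chi S \<in> cube \<rightarrow> cube \<and> is_min_FP (F_M' p chi S) (mw p chi S P2)"
    "F_E p chi S \<in> cube \<rightarrow> cube \<and> is_min_FP (F_E p chi S) (esw p chi S)"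
    by (rule win_prob_is_min_FP; simp add: outcome_map_unfolds)+
  moreover have
    "F_N chi S \<in> cube \<rightarrow> cube \<and> (\<exists>z. is_max_FP (F_N chi S) z \<and> nl p chi S P1 = (\<lambda>j. 1 - z j))"
    "F_N' chi S \<in> cube \<rightarrow> cube \<and> (\<exists>z. is_max_FP (F_N' chi S) z \<and> nl p chi S P2 = (\<lambda>j. 1 - z j))"
    "F_M p chi S \<in> cube \<rightarrow> cube \<and> (\<exists>z. is_max_FP (F_M p chi S) z \<and> ml p chi S P1 = (\<lambda>j. 1 - z j))"
    "F_M' p chi S \<in> cube \<rightarrow> cube \<and> (\<exists>z. is_max_FP (F_M' p chi S) z \<and> ml p chi S P2 = (\<lambda>j. 1 - z j))"
    "F_E' p chi S \<in> cube \<rightarrow> cube \<and> (\<exists>z. is_max_FP (F_E' p chi S) z \<and> eel p chi S = (\<lambda>j. 1 - z j))"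
    by (rule loss_prob_is_max_FP; simp add: outcome_map_unfolds)+
  ultimately show ?thesis
    by (elim conjE, intro conjI) assumption+
qed

end
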